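(* Let $\mathbf{x}_1,\ldots,\mathbf{x}_m\in\mathbb{R}^p$ be pairwise distinct vectors, let $1\le t<m$, and let $k\in\{1,\ldots,m\}\setminus\{1,\ldots,t\}$. The following three statements are equivalent. (i) There exists an increasing quasi-concave function $\vartheta:\mathbb{R}^p\to\mathbb{R}$ satisfying $\vartheta(\mathbf{x}_j)>\vartheta(\mathbf{x}_k)$ for all $j=1,2,\ldots,t$. (ii) There exists an increasing linear function $\vartheta:\mathbb{R}^p\to\mathbb{R}$ satisfying $\vartheta(\mathbf{x}_j)>\vartheta(\mathbf{x}_k)$ for all $j=1,2,\ldots,t$. (iii) The optimal value of the following linear program, in the variables $\mathbf{d}\in\mathbb{R}^p$, $s_1,\ldots,s_{t+p}\in\mathbb{R}$, $r_1,\ldots,r_{t+p}\in\mathbb{R}$, is zero: $$\begin{array}{lll}\min & \sum_{j=1}^{t+p} r_j & \\ \text{s.t.} & (\mathbf{x}_j-\mathbf{x}_k)^T\mathbf{d}-s_j+r_j=1, & j=1,\ldots,t,\\ & d_i-s_{t+i}+r_{t+i}=1, & i=1,\ldots,p,\\ & s_j,r_j\geq 0, & j=1,\ldots,t+p,\\ & \mathbf{d}\geq \mathbf{0}. & \end{array}$$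
   Context: Vector inequalities are understood componentwise. A function $f:\mathbb{R}^p\to\mathbb{R}$ is quasi-concave if $f(\lambda\mathbf{x}+(1-\lambda)\mathbf{y})\ge\min\{f(\mathbf{x}),f(\mathbf{y})\}$ for all $\mathbf{x},\mathbf{y}\in\mathbb{R}^p$ and $\lambda\in[0,1]$. It is increasing if $\mathbf{x}\le\mathbf{y}$ implies $f(\mathbf{x})\le f(\mathbf{y})$. *)

theory Defs
  imports "HOL-Analysis.Analysis"
begin

definition quasi_concave :: "('a::real_vector \<Rightarrow> real) \<Rightarrow> bool" where
  "quasi_concave f \<longleftrightarrow>
     (\<forall>x y. \<forall>l\<in>{0..1::real}. f (l *\<^sub>R x + (1 - l) *\<^sub>R y) \<ge> min (f x) (f y))"

text \<open>The row indices \<open>1, ..., t + p\<close> of the linear program are rendered as the disjoint sum of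
  \<open>{1..t}\<close> and the coordinate index type: \<open>Inl j\<close> stands for \<open>j\<close> and \<open>Inr i\<close> for \<open>t + i\<close>.
  Values of \<open>s\<close> and \<open>r\<close> outside this set are not variables of the program.\<close>

definition lp_rows :: "nat \<Rightarrow> (nat + 'p) set" where
  "lp_rows t = {1..t} <+> UNIV"

type_synonym 'p lp_point = "(real^'p) \<times> (nat + 'p \<Rightarrow> real) \<times> (nat + 'p \<Rightarrow> real)"

definition lp_feasible :: "(nat \<Rightarrow> real^'p) \<Rightarrow> nat \<Rightarrow> nat \<Rightarrow> 'p::finite lp_point \<Rightarrow> bool" where
  "lp_feasible x t k = (\<lambda>(d, s, r).
     (\<forall>j\<in>{1..t}. (x j - x k) \<bullet> d - s (Inl j) + r (Inl j) = 1) \<and>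
     (\<forall>i. d $ i - s (Inr i) + r (Inr i) = 1) \<and>
     (\<forall>j\<in>lp_rows t. s j \<ge> 0 \<and> r j \<ge> 0) \<and>
     d \<ge> 0)"

definition lp_objective :: "nat \<Rightarrow> 'p::finite lp_point \<Rightarrow> real" where
  "lp_objective t = (\<lambda>(d, s, r). \<Sum>j\<in>lp_rows t. r j)"

definition is_optimal_value :: "('a \<Rightarrow> real) \<Rightarrow> ('a \<Rightarrow> bool) \<Rightarrow> real \<Rightarrow> bool" where
  "is_optimal_value obj feas v \<longleftrightarrow> (\<exists>z. is_arg_min obj feas z \<and> obj z = v)"

end

theory Submission
  imports Defs
begin

text \<open>A quasi-concave increasing function separating \<open>x\<^sub>k\<close> from the \<open>x\<^sub>j\<close> forces the convex hull of the
  \<open>x\<^sub>j\<close> to miss the orthant of points below \<open>x\<^sub>k\<close>. A hyperplane strictly separating these two sets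
  has a nonnegative normal, because the orthant is unbounded in every negative coordinate direction.
  For the linear program, objective value zero means that \<open>d \<ge> 1\<close> and \<open>(x\<^sub>j - x\<^sub>k)\<^sup>T d \<ge> 1\<close>; from a
  nonnegative normal \<open>a\<close> such a \<open>d\<close> arises as \<open>c a + 1\<close> with \<open>c\<close> large.\<close>

text \<open>Convexity of strict superlevel sets carries a bound from finitely many points over to
  their convex hull.\<close>

lemma quasi_concave_convex_superlevel:
  assumes "quasi_concave f"
  shows "convex {z. c < f z}"
proof (rule convexI)
  fix y z and u v :: real
  assume yz: "y \<in> {z. c < f z}" "z \<in> {z. c < f z}" and uv: "0 \<le> u" "0 \<le> v" "u + v = 1"
  from uv have v: "v = 1 - u" and "u \<in> {0..1}" by auto
  with assms have "min (f y) (f z) \<le> f (u *\<^sub>R y + v *\<^sub>R z)"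
    unfolding quasi_concave_def by blast
  with yz show "u *\<^sub>R y + v *\<^sub>R z \<in> {z. c < f z}" by auto
qed

lemma linear_imp_quasi_concave:
  fixes f :: "'a::real_vector \<Rightarrow> real"
  assumes "linear f"
  shows "quasi_concave f"
  unfolding quasi_concave_def
proof (intro allI ballI)
  fix x y :: 'a and l :: real
  assume l: "l \<in> {0..1}"
  have "min (f x) (f y) = l * min (f x) (f y) + (1 - l) * min (f x) (f y)"
    by (simp add: algebra_simps)
  also have "\<dots> \<le> l * f x + (1 - l) * f y"
    using l by (intro add_mono mult_left_mono) auto
  also have "\<dots> = f (l *\<^sub>R x + (1 - l) *\<^sub>R y)"
    by (simp add: linear_add[OF assms] linear_cmul[OF assms])
  finally show "min (f x) (f y) \<le> f (l *\<^sub>R x + (1 - l) *\<^sub>R y)" .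
qed

lemma mono_inner_vec:
  fixes a :: "real^'n"
  assumes "0 \<le> a"
  shows "mono (\<lambda>z. a \<bullet> z)"
  using assms by (auto simp: mono_def less_eq_vec_def inner_vec_def intro!: sum_mono mult_left_mono)

text \<open>The Riesz vector of \<open>f\<close> is \<open>adjoint f 1\<close>. Its
  \<open>i\<close>-th entry is the value of \<open>f\<close> at the \<open>i\<close>-th unit vector,
  which lies above \<open>0\<close>, so monotonicity makes it nonnegative.\<close>

lemma mono_linear_functional_vec:
  fixes f :: "real^'n \<Rightarrow> real"
  assumes "mono f" and "linear f"
  obtains a where "0 \<le> a" and "\<And>z. f z = a \<bullet> z"
proof
  show f: "f z = adjoint f 1 \<bullet> z" for z
    using adjoint_works[OF assms(2), of z 1] by (simp add: inner_commute)
  have "0 \<le> adjoint f 1 $ i" for i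
  proof -
    have "f 0 \<le> f (axis i 1)"
      by (intro monoD[OF assms(1)]) (simp add: less_eq_vec_def axis_def)
    then show ?thesis
      by (simp add: linear_0[OF assms(2)] f inner_axis)
  qed
  then show "0 \<le> adjoint f 1"
    by (simp add: less_eq_vec_def)
qed

lemma convex_atMost_vec: "convex {..y :: real^'n}"
proof -
  have "{..y} = (\<Inter>i. {z. axis i 1 \<bullet> z \<le> y $ i})"
    by (auto simp: less_eq_vec_def inner_axis')
  then show ?thesis
    by (simp add: convex_INT convex_halfspace_le)
qed

lemma separate_compact_from_atMost:
  fixes K :: "(real^'n) set"
  assumes K: "convex K" "compact K" "K \<noteq> {}" and disj: "K \<inter> {..y} = {}"
  obtains a where "0 \<le> a" and "\<And>u. u \<in> K \<Longrightarrow> a \<bullet> y < a \<bullet> u"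
proof -
  obtain a b where aK: "\<And>u. u \<in> K \<Longrightarrow> a \<bullet> u < b" and ay: "\<And>z. z \<le> y \<Longrightarrow> b < a \<bullet> z"
    using separating_hyperplane_compact_closed[OF K convex_atMost_vec closed_eucl_atMost disj]
    by auto
  have "a $ i \<le> 0" for i
  proof (rule ccontr)
    assume "\<not> a $ i \<le> 0"
    then have pos: "0 < a $ i" by simp
    \<comment> \<open>Moving down from \<open>y\<close> by \<open>M\<close> in direction
      \<open>i\<close> stays in the orthant but lands exactly on the hyperplane, contradicting
      strict separation.\<close>
    define M where "M = (a \<bullet> y - b) / a $ i"
    have "0 \<le> M"
      using ay[of y] pos by (simp add: M_def)
    then have "b < a \<bullet> (y - M *\<^sub>R axis i 1)"
      by (intro ay) (simp add: less_eq_vec_def axis_def)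
    also have "\<dots> = b"
      using pos by (simp add: inner_diff_right inner_axis M_def)
    finally show False by simp
  qed
  \<comment> \<open>The hyperplane has \<open>K\<close> on its lower side, so the required normal is
    \<open>- a\<close>.\<close>
  then have "0 \<le> - a"
    by (simp add: less_eq_vec_def)
  moreover have "- a \<bullet> y < - a \<bullet> u" if "u \<in> K" for u
    using aK[OF that] ay[of y] by simp
  ultimately show ?thesis
    by (rule that)
qed

lemma increasing_quasi_concave_imp_linear:
  fixes f :: "real^'n \<Rightarrow> real"
  assumes f: "mono f" "quasi_concave f"
    and J: "finite J" "J \<noteq> {}" and less: "\<And>j. j \<in> J \<Longrightarrow> f y < f (x j)"
  obtains g :: "real^'n \<Rightarrow> real"
  where "mono g" and "linear g" and "\<And>j. j \<in> J \<Longrightarrow> g y < g (x j)"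
proof -
  let ?K = "convex hull (x ` J)"
  have "?K \<subseteq> {z. f y < f z}"
    using less by (intro hull_minimal quasi_concave_convex_superlevel f) auto
  \<comment> \<open>By monotonicity, no point below \<open>y\<close> has a value above
    \<open>f y\<close>.\<close>
  then have disj: "?K \<inter> {..y} = {}"
    using monoD[OF f(1)] by fastforce
  obtain a where a: "0 \<le> a" "\<And>u. u \<in> ?K \<Longrightarrow> a \<bullet> y < a \<bullet> u"
    by (rule separate_compact_from_atMost[OF _ _ _ disj])
      (use J in \<open>auto intro: finite_imp_compact_convex_hull\<close>)
  show ?thesis
  proof
    show "mono (\<lambda>z. a \<bullet> z)"
      using a(1) by (rule mono_inner_vec)
    show "linear (\<lambda>z. a \<bullet> z)"
      by (rule bounded_linear.linear[OF bounded_linear_inner_right])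
    show "a \<bullet> y < a \<bullet> x j" if "j \<in> J" for j
      using that by (intro a(2) hull_inc) auto
  qed
qed

lemma finite_lp_rows: "finite (lp_rows t :: (nat + 'p::finite) set)"
  by (simp add: lp_rows_def)

lemma ball_lp_rows: "(\<forall>j\<in>lp_rows t. P j) \<longleftrightarrow> (\<forall>j\<in>{1..t}. P (Inl j)) \<and> (\<forall>i. P (Inr i))"
  by (auto simp: lp_rows_def)

text \<open>Zero is a lower bound, so any feasible point with objective zero is automatically
  optimal.\<close>

lemma lp_objective_nonneg:
  assumes "lp_feasible x t k z"
  shows "0 \<le> lp_objective t z"
  using assms by (auto simp: lp_feasible_def lp_objective_def intro!: sum_nonneg split: prod.splits)

text \<open>In each row, \<open>s\<close> absorbs a surplus over 1 and \<open>r\<close> a shortfall.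
  Objective zero rules out any shortfall, which turns the equations into inequalities.\<close>

lemma optimal_value_0_iff:
  fixes x :: "nat \<Rightarrow> real^'p"
  shows "is_optimal_value (lp_objective t) (lp_feasible x t k) 0
    \<longleftrightarrow> (\<exists>d. (\<forall>j\<in>{1..t}. 1 \<le> (x j - x k) \<bullet> d) \<and> (\<forall>i. 1 \<le> d $ i))" (is "?L \<longleftrightarrow> ?R")
proof
  assume ?L
  then obtain d s r where feas: "lp_feasible x t k (d, s, r)" and obj: "lp_objective t (d, s, r) = 0"
    unfolding is_optimal_value_def is_arg_min_def by auto
  have "\<forall>j\<in>lp_rows t. r j = 0"
    using obj feas sum_nonneg_eq_0_iff[OF finite_lp_rows[of t], of r]
    by (simp add: lp_objective_def lp_feasible_def)
  moreover have "1 \<le> (x j - x k) \<bullet> d + r (Inl j)" if "j \<in> {1..t}" for j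
    using feas that by (force simp: lp_feasible_def ball_lp_rows)
  moreover have "1 \<le> d $ i + r (Inr i)" for i
    using feas unfolding lp_feasible_def ball_lp_rows by (smt (verit) case_prod_conv)
  ultimately have "(\<forall>j\<in>{1..t}. 1 \<le> (x j - x k) \<bullet> d) \<and> (\<forall>i. 1 \<le> d $ i)"
    by (simp add: ball_lp_rows)
  then show ?R ..
next
  assume ?R
  then obtain d where d: "\<And>j. j \<in> {1..t} \<Longrightarrow> 1 \<le> (x j - x k) \<bullet> d" "\<And>i. 1 \<le> d $ i"
    by blast
  \<comment> \<open>The surplus of each row over 1 goes entirely into \<open>s\<close>.\<close>
  define z where "z = (d, case_sum (\<lambda>j. (x j - x k) \<bullet> d - 1) (\<lambda>i. d $ i - 1), \<lambda>_ :: nat + 'p. 0 :: real)"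
  have "0 \<le> d $ i" for i
    using d(2)[of i] by simp
  then have feas: "lp_feasible x t k z"
    using d by (simp add: z_def lp_feasible_def ball_lp_rows less_eq_vec_def)
  have obj: "lp_objective t z = 0"
    by (simp add: z_def lp_objective_def)
  show ?L
    unfolding is_optimal_value_def is_arg_min_def
    using feas obj lp_objective_nonneg[of x t k] by (metis not_less)
qed

text \<open>Strict homogeneous inequalities can be scaled up to any margin. Adding the all-ones
  vector \<open>1\<close> secures \<open>1 \<le> d $ i\<close> even where the normal has a zero
  entry.\<close>

lemma mono_linear_iff_lp_solvable:
  fixes x :: "nat \<Rightarrow> real^'p"
  shows "(\<exists>f :: real^'p \<Rightarrow> real. mono f \<and> linear f \<and> (\<forall>j\<in>{1..t}. f (x j) > f (x k)))
    \<longleftrightarrow> (\<exists>d. (\<forall>j\<in>{1..t}. 1 \<le> (x j - x k) \<bullet> d) \<and> (\<forall>i. 1 \<le> d $ i))" (is "?L \<longleftrightarrow> ?R")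
proof
  assume ?L
  then obtain f :: "real^'p \<Rightarrow> real"
    where f: "mono f" "linear f" and less: "\<And>j. j \<in> {1..t} \<Longrightarrow> f (x k) < f (x j)"
    by blast
  obtain a where a: "0 \<le> a" and fa: "\<And>z. f z = a \<bullet> z"
    using mono_linear_functional_vec[OF f] by blast
  have "eventually (\<lambda>c. 1 \<le> (x j - x k) \<bullet> (c *\<^sub>R a + 1)) at_top" if "j \<in> {1..t}" for j
  proof -
    have pos: "0 < (x j - x k) \<bullet> a"
      using less[OF that] by (simp add: fa inner_diff_right inner_commute[of _ a])
    show ?thesis
      \<comment> \<open>The left side is affine in \<open>c\<close> with positive slope; this
        threshold is where it reaches 1.\<close>
      using eventually_ge_at_top[of "(1 - (x j - x k) \<bullet> 1) / ((x j - x k) \<bullet> a)"]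
    proof eventually_elim
      case (elim c)
      then show ?case
        using pos by (simp add: pos_divide_le_eq inner_add_right)
    qed
  qed
  \<comment> \<open>Finiteness of the index set lets one \<open>c\<close> serve all
    \<open>j\<close>.\<close>
  then have "eventually (\<lambda>c. \<forall>j\<in>{1..t}. 1 \<le> (x j - x k) \<bullet> (c *\<^sub>R a + 1)) at_top"
    by (simp add: eventually_ball_finite)
  then have "eventually (\<lambda>c::real. 0 \<le> c \<and> (\<forall>j\<in>{1..t}. 1 \<le> (x j - x k) \<bullet> (c *\<^sub>R a + 1))) at_top"
    by (intro eventually_conj eventually_ge_at_top)
  then obtain c :: real where "0 \<le> c" "\<forall>j\<in>{1..t}. 1 \<le> (x j - x k) \<bullet> (c *\<^sub>R a + 1)"
    by (metis (no_types, lifting) eventually_happens trivial_limit_at_top_linorder)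
  moreover have "1 \<le> (c *\<^sub>R a + 1) $ i" for i
    using a \<open>0 \<le> c\<close> by (simp add: less_eq_vec_def)
  ultimately show ?R
    by blast
next
  assume ?R
  then obtain d where d: "\<And>j. j \<in> {1..t} \<Longrightarrow> 1 \<le> (x j - x k) \<bullet> d" "\<And>i. 1 \<le> d $ i"
    by blast
  have "0 \<le> d $ i" for i
    using d(2)[of i] by simp
  then have "mono (\<lambda>z. d \<bullet> z)"
    by (intro mono_inner_vec) (simp add: less_eq_vec_def)
  moreover have "linear (\<lambda>z. d \<bullet> z)"
    by (rule bounded_linear.linear[OF bounded_linear_inner_right])
  moreover have "d \<bullet> x k < d \<bullet> x j" if "j \<in> {1..t}" for j
    using d(1)[OF that] by (simp add: inner_diff_right inner_commute[of _ d])
  ultimately show ?L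
    by blast
qed

theorem theorem3p6:
  fixes x :: "nat \<Rightarrow> real^'p" and m t k :: nat
  assumes "inj_on x {1..m}"
    and "1 \<le> t" and "t < m"
    and "k \<in> {1..m} - {1..t}"
  shows "((\<exists>f :: real^'p \<Rightarrow> real. mono f \<and> quasi_concave f \<and> (\<forall>j\<in>{1..t}. f (x j) > f (x k)))
           \<longleftrightarrow> (\<exists>f :: real^'p \<Rightarrow> real. mono f \<and> linear f \<and> (\<forall>j\<in>{1..t}. f (x j) > f (x k))))
       \<and> ((\<exists>f :: real^'p \<Rightarrow> real. mono f \<and> linear f \<and> (\<forall>j\<in>{1..t}. f (x j) > f (x k)))
           \<longleftrightarrow> is_optimal_value (lp_objective t) (lp_feasible x t k) 0)"
    (is "(?i \<longleftrightarrow> ?ii) \<and> (?ii \<longleftrightarrow> ?iii)")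
proof (intro conjI iffI)
  assume ?i
  then obtain f :: "real^'p \<Rightarrow> real"
    where "mono f" "quasi_concave f" "\<And>j. j \<in> {1..t} \<Longrightarrow> f (x k) < f (x j)"
    by blast
  moreover have "{1..t} \<noteq> {}"
    using assms(2) by simp
  ultimately obtain g :: "real^'p \<Rightarrow> real"
    where "mono g" "linear g" "\<And>j. j \<in> {1..t} \<Longrightarrow> g (x k) < g (x j)"
    using increasing_quasi_concave_imp_linear[of f "{1..t}" "x k" x] by blast
  then show ?ii
    by blast
next
  assume ?ii
  then show ?i
    using linear_imp_quasi_concave by blast
\<comment> \<open>Both directions between \<open>?ii\<close> and \<open>?iii\<close> remain; each
  side rewrites to solvability of the same system of inequalities in \<open>d\<close>.\<close>
qed (simp_all only: optimal_value_0_iff mono_linear_iff_lp_solvable)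

end
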